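(* Every sequence of roux lines has unit-norm representatives that form an equiangular tight frame for their span.
   Context: Let $\Gamma$ be a finite multiplicative abelian group, identified with its image in the group ring $\mathbb{C}[\Gamma]$. A roux for $\Gamma$ is a matrix $B\in\mathbb{C}[\Gamma]^{n\times n}$ such that: (R1) $B_{ii}=0$ for every $i$; (R2) $B_{ij}\in\Gamma$ for $i\ne j$; (R3) $B_{ji}=(B_{ij})^{-1}$ for $i\neq j$; (R4) the matrices $\{gI\}_{g\in\Gamma}$ and $\{gB\}_{g\in\Gamma}$ span an algebra. For a character $\alpha\in\hat\Gamma$ (a homomorphism from $\Gamma$ to the complex unit circle), $\hat\alpha(B)\in\mathbb{C}^{n\times n}$ denotes the result of extending $\alpha$ linearly to $\mathbb{C}[\Gamma]$ and applying it to each entry of $B$ ("evaluating $B$ at $\alpha$"). Lines are one-dimensional complex subspaces. A sequence of $n$ lines is linearly dependent if their span has dimension $d<n$. A signature matrix is a self-adjoint matrix with zero diagonal and unit-modulus off-diagonal entries. Unit vectors $\{\varphi_i\}_{i\in[n]}$ have signature matrix $\mathcal S$ if their Gram matrix $(\langle\varphi_j,\varphi_i\rangle)_{ij}$ equals $I+\mu\mathcal S$ with $\mu>0$. Roux lines are any sequence of linearly dependent lines for which there exist unit-norm representatives whose signature matrix is $\hat\alpha(B)$ for some roux $B$ for some finite abelian group $\Gamma$ and some $\alpha\in\hat\Gamma$. Unit vectors $\{\varphi_i\}_{i\in[n]}$ form an equiangular tight frame for their span if $|\langle\varphi_i,\varphi_j\rangle|^2$ is the same for all $i\ne j$ and $\sum_i\varphi_i\varphi_i^*$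 is a scalar multiple of the orthogonal projection onto their span. *)

theory Defs
  imports "HOL-Analysis.Analysis" "HOL-Library.Poly_Mapping"
begin

(* The finite abelian group Gamma is a type 'g of class finite and ab_group_add, so its
   group law is written additively. The group ring C[Gamma] is the type of finitely supported
   functions 'g => complex with the convolution product of HOL-Library.Poly_Mapping,
   under which of_grp turns the addition of 'g into multiplication. *)

type_synonym 'g group_ring = "'g \<Rightarrow>\<^sub>0 complex"

definition of_grp :: "'g::ab_group_add \<Rightarrow> 'g group_ring" where
  "of_grp g = Poly_Mapping.single g 1"

lemma of_grp_add: "of_grp (g + h) = of_grp g * of_grp h"
  by (simp add: of_grp_def mult_single)

lemma of_grp_0: "of_grp 0 = 1"
  by (simp add: of_grp_def)

lemma of_grp_minus: "of_grp (- g) * of_grp g = 1"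
  by (metis add.left_inverse of_grp_0 of_grp_add)

lemma inj_of_grp: "inj of_grp"
  by (rule injI) (metis lookup_single_eq lookup_single_not_eq of_grp_def zero_neq_one)

definition scale_mat :: "'a::semiring_1 \<Rightarrow> 'a^'m^'n \<Rightarrow> 'a^'m^'n" where
  "scale_mat x A = (\<chi> i j. x * A $ i $ j)"

(* C[Gamma] is a complex algebra through the scalars c |-> c * 1. *)
interpretation roux_space: vector_space
  "\<lambda>(c::complex) (A::('g::ab_group_add group_ring)^'n::finite^'n). scale_mat (Poly_Mapping.single 0 c) A"
  by unfold_locales
    (simp_all add: scale_mat_def vec_eq_iff algebra_simps single_add mult_single
      flip: mult.assoc)

definition roux_span :: "('g::ab_group_add group_ring)^'n^'n \<Rightarrow> (('g group_ring)^'n^'n) set" where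
  "roux_span B = roux_space.span
     (range (\<lambda>g. scale_mat (of_grp g) (mat 1)) \<union> range (\<lambda>g. scale_mat (of_grp g) B))"

(* The last clause: the span contains the identity matrix, so it is an algebra
   iff it is closed under the matrix product. *)
definition roux :: "('g::{finite, ab_group_add} group_ring)^'n^'n \<Rightarrow> bool" where
  "roux B \<longleftrightarrow>
     (\<forall>i. B $ i $ i = 0) \<and>
     (\<forall>i j. i \<noteq> j \<longrightarrow> B $ i $ j \<in> range of_grp) \<and>
     (\<forall>i j g. i \<noteq> j \<longrightarrow> B $ i $ j = of_grp g \<longrightarrow> B $ j $ i = of_grp (- g)) \<and>
     (\<forall>X \<in> roux_span B. \<forall>Y \<in> roux_span B. X ** Y \<in> roux_span B)"

definition character :: "('g::ab_group_add \<Rightarrow> complex) \<Rightarrow> bool" where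
  "character \<alpha> \<longleftrightarrow> (\<forall>g h. \<alpha> (g + h) = \<alpha> g * \<alpha> h) \<and> (\<forall>g. cmod (\<alpha> g) = 1)"

definition char_ext :: "('g::{finite, ab_group_add} \<Rightarrow> complex) \<Rightarrow> 'g group_ring \<Rightarrow> complex" where
  "char_ext \<alpha> x = (\<Sum>g\<in>UNIV. Poly_Mapping.lookup x g * \<alpha> g)"

definition eval_char ::
    "('g::{finite, ab_group_add} \<Rightarrow> complex) \<Rightarrow> ('g group_ring)^'n^'n \<Rightarrow> complex^'n^'n" where
  "eval_char \<alpha> B = (\<chi> i j. char_ext \<alpha> (B $ i $ j))"

(* Hermitian inner product, linear in the first argument. The class operation inner on
   complex^'d is only its real part; norm is the norm belonging to both. *)
definition cinner :: "complex^'d \<Rightarrow> complex^'d \<Rightarrow> complex" where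
  "cinner x y = (\<Sum>k\<in>UNIV. x $ k * cnj (y $ k))"

lemma cinner_self: "cinner x x = of_real ((norm x)\<^sup>2)"
  unfolding cinner_def norm_vec_def L2_set_def
  by (simp add: sum_nonneg complex_norm_square of_real_sum del: of_real_power)

definition signature_matrix :: "complex^'n^'n \<Rightarrow> bool" where
  "signature_matrix S \<longleftrightarrow>
     (\<forall>i j. S $ j $ i = cnj (S $ i $ j)) \<and>
     (\<forall>i. S $ i $ i = 0) \<and>
     (\<forall>i j. i \<noteq> j \<longrightarrow> cmod (S $ i $ j) = 1)"

definition gram :: "('n \<Rightarrow> complex^'d) \<Rightarrow> complex^'n^'n" where
  "gram \<phi> = (\<chi> i j. cinner (\<phi> j) (\<phi> i))"

definition has_signature_matrix :: "('n \<Rightarrow> complex^'d) \<Rightarrow> complex^'n^'n \<Rightarrow> bool" where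
  "has_signature_matrix \<phi> S \<longleftrightarrow>
     (\<forall>i. norm (\<phi> i) = 1) \<and> signature_matrix S \<and>
     (\<exists>\<mu>::real. \<mu> > 0 \<and> gram \<phi> = mat 1 + scale_mat (of_real \<mu>) S)"

definition line :: "(complex^'d) set \<Rightarrow> bool" where
  "line l \<longleftrightarrow> vec.subspace l \<and> vec.dim l = 1"

definition linearly_dependent_lines :: "('n::finite \<Rightarrow> (complex^'d) set) \<Rightarrow> bool" where
  "linearly_dependent_lines L \<longleftrightarrow> vec.dim (vec.span (\<Union>i. L i)) < CARD('n)"

definition unit_norm_representatives ::
    "('n \<Rightarrow> (complex^'d) set) \<Rightarrow> ('n \<Rightarrow> complex^'d) \<Rightarrow> bool" where
  "unit_norm_representatives L \<phi> \<longleftrightarrow> (\<forall>i. \<phi> i \<in> L i \<and> norm (\<phi> i) = 1)"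

(* The group Gamma ranges over group structures on types, so it enters as a type argument;
   a statement about all roux lines has 'g as a free type variable. *)
definition roux_lines ::
    "'g::{finite, ab_group_add} itself \<Rightarrow> ('n::finite \<Rightarrow> (complex^'d) set) \<Rightarrow> bool" where
  "roux_lines T L \<longleftrightarrow>
     (\<forall>i. line (L i)) \<and> linearly_dependent_lines L \<and>
     (\<exists>\<phi> (B::('g group_ring)^'n^'n) \<alpha>.
        unit_norm_representatives L \<phi> \<and> roux B \<and> character \<alpha> \<and>
        has_signature_matrix \<phi> (eval_char \<alpha> B))"

definition orthogonal_projection :: "complex^'d^'d \<Rightarrow> (complex^'d) set \<Rightarrow> bool" where
  "orthogonal_projection P W \<longleftrightarrow>
     (\<forall>x. P *v x \<in> W \<and> (\<forall>w\<in>W. cinner (x - P *v x) w = 0))"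

definition outer :: "complex^'d \<Rightarrow> complex^'d^'d" where
  "outer x = (\<chi> k l. x $ k * cnj (x $ l))"

definition etf_for_span :: "('n::finite \<Rightarrow> complex^'d) \<Rightarrow> bool" where
  "etf_for_span \<phi> \<longleftrightarrow>
     (\<forall>i. norm (\<phi> i) = 1) \<and>
     (\<exists>c. \<forall>i j. i \<noteq> j \<longrightarrow> (cmod (cinner (\<phi> i) (\<phi> j)))\<^sup>2 = c) \<and>
     (\<exists>P a. orthogonal_projection P (vec.span (range \<phi>)) \<and>
            (\<Sum>i\<in>UNIV. outer (\<phi> i)) = scale_mat a P)"

end

theory Submission
  imports Defs
begin

text \<open>Evaluating the roux algebra at a character shows that the signature matrix is the root of a
monic quadratic, so the Gram matrix \<open>G\<close> satisfies \<open>G\<^sup>2 = p I + q G\<close>. Linear dependence of the lines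
makes \<open>G\<close> singular, which forces \<open>p = 0\<close>; then the frame operator acts as \<open>q\<close> on the span of the
vectors.\<close>

section \<open>Characters extended linearly to the group ring\<close>

lemma character_0: "character \<alpha> \<Longrightarrow> \<alpha> 0 = 1"
proof -
  assume "character \<alpha>"
  then have "\<alpha> (0 + 0) = \<alpha> 0 * \<alpha> 0" "cmod (\<alpha> 0) = 1"
    unfolding character_def by blast+
  then show ?thesis by auto
qed

lemma char_ext_add: "char_ext \<alpha> (x + y) = char_ext \<alpha> x + char_ext \<alpha> y"
  by (simp add: char_ext_def lookup_add algebra_simps sum.distrib)

lemma char_ext_zero [simp]: "char_ext \<alpha> 0 = 0"
  by (simp add: char_ext_def)

lemma char_ext_sum: "char_ext \<alpha> (sum f A) = (\<Sum>i\<in>A. char_ext \<alpha> (f i))"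
  by (induction A rule: infinite_finite_induct) (simp_all add: char_ext_add)

lemma char_ext_single: "char_ext \<alpha> (Poly_Mapping.single g c) = c * \<alpha> g"
  by (simp add: char_ext_def lookup_single when_def if_distrib [of "\<lambda>x. x * _"] cong: if_cong)

text \<open>Both sides are bilinear in \<open>x\<close> and \<open>y\<close>, so it suffices to
  compare them on group elements, where the claim is that \<alpha> is a homomorphism.\<close>

lemma char_ext_mult:
  assumes "character \<alpha>"
  shows "char_ext \<alpha> (x * y) = char_ext \<alpha> x * char_ext \<alpha> y"
proof -
  have expand: "z = (\<Sum>g\<in>UNIV. Poly_Mapping.single g (Poly_Mapping.lookup z g))"
    for z :: "'a group_ring"
    by (rule poly_mapping_eqI) (simp add: lookup_sum lookup_single when_def)
  have "x * y = (\<Sum>g\<in>UNIV. \<Sum>h\<in>UNIV.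
      Poly_Mapping.single (g + h) (Poly_Mapping.lookup x g * Poly_Mapping.lookup y h))"
    by (subst expand [of x], subst expand [of y]) (simp add: sum_product mult_single)
  then have "char_ext \<alpha> (x * y) = (\<Sum>g\<in>UNIV. \<Sum>h\<in>UNIV.
      Poly_Mapping.lookup x g * Poly_Mapping.lookup y h * \<alpha> (g + h))"
    by (simp add: char_ext_sum char_ext_single)
  also have "\<dots> = char_ext \<alpha> x * char_ext \<alpha> y"
    using assms by (simp add: character_def char_ext_def sum_product mult_ac)
  finally show ?thesis .
qed

section \<open>Evaluation of the roux algebra at a character\<close>

lemma eval_char_add: "eval_char \<alpha> (X + Y) = eval_char \<alpha> X + eval_char \<alpha> Y"
  by (simp add: eval_char_def vec_eq_iff char_ext_add)

lemma eval_char_scale_mat: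
  "character \<alpha> \<Longrightarrow> eval_char \<alpha> (scale_mat x X) = scale_mat (char_ext \<alpha> x) (eval_char \<alpha> X)"
  by (simp add: eval_char_def scale_mat_def vec_eq_iff char_ext_mult)

lemma eval_char_mat_1: "character \<alpha> \<Longrightarrow> eval_char \<alpha> (mat 1) = mat 1"
  using char_ext_single [of \<alpha> 0 1]
  by (auto simp: eval_char_def mat_def vec_eq_iff character_0)

lemma eval_char_matrix_mult:
  "character \<alpha> \<Longrightarrow> eval_char \<alpha> (X ** Y) = eval_char \<alpha> X ** eval_char \<alpha> Y"
  by (simp add: eval_char_def matrix_matrix_mult_def vec_eq_iff char_ext_sum char_ext_mult)

text \<open>Evaluation turns each group element \<open>g\<close> into the scalar
  \<open>\<alpha> g\<close>. The generators \<open>gI\<close> and \<open>gB\<close> therefore all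
  collapse into the complex span of \<open>I\<close> and the evaluated \<open>B\<close>, and
  linearity extends this to the whole span.\<close>

lemma eval_char_roux_span:
  fixes B :: "('g::{finite, ab_group_add} group_ring)^'n::finite^'n"
  assumes \<alpha>: "character \<alpha>" and X: "X \<in> roux_span B"
  shows "\<exists>a b. eval_char \<alpha> X = scale_mat a (mat 1) + scale_mat b (eval_char \<alpha> B)"
proof -
  define V where
    "V = {X. \<exists>a b. eval_char \<alpha> X = scale_mat a (mat 1) + scale_mat b (eval_char \<alpha> B)}"
  have mem: "X \<in> V" if "eval_char \<alpha> X = scale_mat a (mat 1) + scale_mat b (eval_char \<alpha> B)" for X a b
    using that unfolding V_def by blast
  have "roux_space.subspace V"
  proof (rule roux_space.subspaceI)
    show "0 \<in> V"
      by (rule mem [of _ 0 0]) (simp add: eval_char_def scale_mat_def vec_eq_iff)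
  next
    fix X Y assume "X \<in> V" "Y \<in> V"
    then obtain a b c d where
      "eval_char \<alpha> X = scale_mat a (mat 1) + scale_mat b (eval_char \<alpha> B)"
      "eval_char \<alpha> Y = scale_mat c (mat 1) + scale_mat d (eval_char \<alpha> B)"
      unfolding V_def by blast
    then show "X + Y \<in> V"
      by (intro mem [of _ "a + c" "b + d"])
        (simp add: eval_char_add scale_mat_def vec_eq_iff algebra_simps)
  next
    fix c X assume "X \<in> V"
    then obtain a b where
      "eval_char \<alpha> X = scale_mat a (mat 1) + scale_mat b (eval_char \<alpha> B)"
      unfolding V_def by blast
    \<comment> \<open>A scalar \<open>c\<close> sits in the group ring as
      \<open>Poly_Mapping.single 0 c\<close>, which evaluates to
      \<open>c * \<alpha> 0 = c\<close>.\<close>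
    then have "eval_char \<alpha> (scale_mat (Poly_Mapping.single 0 c) X)
        = scale_mat (c * a) (mat 1) + scale_mat (c * b) (eval_char \<alpha> B)"
      unfolding eval_char_scale_mat [OF \<alpha>]
      by (simp add: \<alpha> char_ext_single character_0 scale_mat_def vec_eq_iff algebra_simps)
    then show "scale_mat (Poly_Mapping.single 0 c) X \<in> V"
      by (rule mem)
  qed
  moreover have "scale_mat (of_grp g) (mat 1) \<in> V" for g
    by (rule mem [of _ "\<alpha> g" 0], unfold eval_char_scale_mat [OF \<alpha>])
      (simp add: eval_char_mat_1 \<alpha> of_grp_def char_ext_single scale_mat_def vec_eq_iff)
  moreover have "scale_mat (of_grp g) B \<in> V" for g
    by (rule mem [of _ 0 "\<alpha> g"], unfold eval_char_scale_mat [OF \<alpha>])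
      (simp add: of_grp_def char_ext_single scale_mat_def vec_eq_iff)
  ultimately have "roux_span B \<subseteq> V"
    unfolding roux_span_def by (intro roux_space.span_minimal) auto
  with X show ?thesis unfolding V_def by blast
qed

text \<open>The algebra condition (R4) enters here: \<open>B\<close> is itself a generator, the one
  for the neutral element, so \<open>B ** B\<close> stays in the span and is evaluated by the
  preceding lemma.\<close>

lemma roux_eval_char_quadratic:
  fixes B :: "('g::{finite, ab_group_add} group_ring)^'n::finite^'n"
  assumes "roux B" "character \<alpha>"
  shows "\<exists>a b. eval_char \<alpha> B ** eval_char \<alpha> B
    = scale_mat a (mat 1) + scale_mat b (eval_char \<alpha> B)"
proof -
  have "scale_mat (of_grp 0) B \<in> roux_span B"
    unfolding roux_span_def by (intro roux_space.span_base) blast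
  then have "B \<in> roux_span B"
    by (simp add: of_grp_0 scale_mat_def)
  then have "B ** B \<in> roux_span B"
    using assms(1) unfolding roux_def by blast
  then show ?thesis
    using eval_char_roux_span assms(2) by (metis eval_char_matrix_mult)
qed

section \<open>Hermitian inner product and orthogonality to a span\<close>

lemma cinner_add_left: "cinner (x + y) z = cinner x z + cinner y z"
  by (simp add: cinner_def algebra_simps sum.distrib)

lemma cinner_diff_left: "cinner (x - y) z = cinner x z - cinner y z"
  by (simp add: cinner_def algebra_simps sum_subtractf)

lemma cinner_scale_left: "cinner (c *s x) z = c * cinner x z"
  by (simp add: cinner_def sum_distrib_left mult_ac)

lemma cinner_zero_left [simp]: "cinner 0 z = 0"
  by (simp add: cinner_def)

lemma cinner_commute: "cinner y x = cnj (cinner x y)"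
  by (simp add: cinner_def mult.commute)

lemma cinner_sum_left: "cinner (sum f A) z = (\<Sum>i\<in>A. cinner (f i) z)"
  by (induction A rule: infinite_finite_induct) (simp_all add: cinner_add_left)

lemma cinner_eq_zero_span:
  assumes "\<And>s. s \<in> S \<Longrightarrow> cinner x s = 0" and "w \<in> vec.span S"
  shows "cinner x w = 0"
proof -
  \<comment> \<open>The varying vector is put in the first argument, where \<open>cinner\<close> is
    linear; conjugate symmetry transfers the result to the second.\<close>
  have "vec.subspace {w. cinner w x = 0}"
    by (rule vec.subspaceI) (simp_all add: cinner_add_left cinner_scale_left)
  moreover have "S \<subseteq> {w. cinner w x = 0}"
    using assms(1) by (auto simp: cinner_commute [of _ x])
  ultimately have "vec.span S \<subseteq> {w. cinner w x = 0}"
    by (rule vec.span_minimal [rotated])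
  with assms(2) show ?thesis
    by (auto simp: cinner_commute [of w x])
qed

lemma matrix_add_rdistrib: "(A + B) ** C = A ** C + B ** C"
  by (simp add: matrix_matrix_mult_def vec_eq_iff distrib_right sum.distrib)

section \<open>The frame operator and its relation to the Gram matrix\<close>

lemma sum_outer_mult_vec:
  "(\<Sum>i\<in>UNIV. outer (\<phi> i)) *v x = (\<Sum>i\<in>UNIV. cinner x (\<phi> i) *s \<phi> i)"
  for \<phi> :: "'n::finite \<Rightarrow> complex^'d"
  unfolding vec_eq_iff
proof
  fix k
  have "((\<Sum>i\<in>UNIV. outer (\<phi> i)) *v x) $ k
      = (\<Sum>l\<in>UNIV. \<Sum>i\<in>UNIV. \<phi> i $ k * cnj (\<phi> i $ l) * x $ l)"
    by (simp add: matrix_vector_mult_def outer_def sum_distrib_right)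
  also have "\<dots> = (\<Sum>i\<in>UNIV. \<Sum>l\<in>UNIV. \<phi> i $ k * cnj (\<phi> i $ l) * x $ l)"
    by (rule sum.swap)
  also have "\<dots> = (\<Sum>i\<in>UNIV. cinner x (\<phi> i) *s \<phi> i) $ k"
    by (simp add: cinner_def sum_distrib_left mult_ac)
  finally show "((\<Sum>i\<in>UNIV. outer (\<phi> i)) *v x) $ k
      = (\<Sum>i\<in>UNIV. cinner x (\<phi> i) *s \<phi> i) $ k" .
qed

text \<open>Self-adjointness of the frame operator: both sides expand to the sum of
  \<open>cinner x (\<phi> i) * cinner (\<phi> i) y\<close>.\<close>

lemma cinner_sum_outer_commute:
  "cinner ((\<Sum>i\<in>UNIV. outer (\<phi> i)) *v x) y = cinner x ((\<Sum>i\<in>UNIV. outer (\<phi> i)) *v y)"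
  for \<phi> :: "'n::finite \<Rightarrow> complex^'d"
proof -
  have "cinner x (\<Sum>i\<in>UNIV. cinner y (\<phi> i) *s \<phi> i)
      = cnj (cinner (\<Sum>i\<in>UNIV. cinner y (\<phi> i) *s \<phi> i) x)"
    by (rule cinner_commute)
  also have "\<dots> = (\<Sum>i\<in>UNIV. cinner x (\<phi> i) * cinner (\<phi> i) y)"
    by (simp add: cinner_sum_left cinner_scale_left cinner_commute [of "\<phi> _"] mult.commute)
  finally show ?thesis
    by (simp add: sum_outer_mult_vec cinner_sum_left cinner_scale_left)
qed

text \<open>The Gram matrix factors through the synthesis map from coefficients to linear
  combinations of the vectors. Its range has dimension below the number of coefficients, so it has a
  nonzero kernel vector, which the Gram matrix kills as well.\<close>

lemma gram_singular:
  fixes \<phi> :: "'n::finite \<Rightarrow> complex^'d"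
  assumes "vec.dim (range \<phi>) < CARD('n)"
  shows "\<exists>v. v \<noteq> 0 \<and> gram \<phi> *v v = 0"
proof -
  \<comment> \<open>The matrix of the synthesis map, with the vectors as columns.\<close>
  define A :: "complex^'n^'d" where "A = (\<chi> k i. \<phi> i $ k)"
  have A: "A *v v = (\<Sum>i\<in>UNIV. v $ i *s \<phi> i)" for v
    by (simp add: A_def matrix_vector_mult_def vec_eq_iff mult.commute)
  have "\<not> inj ((*v) A)"
  proof
    assume "inj ((*v) A)"
    then have "vec.dim (range ((*v) A)) = CARD('n)"
      by (simp add: vec.dim_image_eq vec_dim_card del: vec.dim_UNIV)
    moreover have "range ((*v) A) \<subseteq> vec.span (range \<phi>)"
      by (auto simp: A intro!: vec.span_sum vec.span_scale intro: vec.span_base)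
    then have "vec.dim (range ((*v) A)) \<le> vec.dim (range \<phi>)"
      by (metis vec.dim_subset vec.dim_span)
    ultimately show False using assms by simp
  qed
  then obtain v where v: "v \<noteq> 0" "A *v v = 0"
    by (metis matrix_left_invertible_injective matrix_left_invertible_ker)
  have "(gram \<phi> *v v) $ i = cinner (A *v v) (\<phi> i)" for i
    unfolding A cinner_sum_left cinner_scale_left
    by (simp add: gram_def matrix_vector_mult_def mult.commute)
  then have "gram \<phi> *v v = 0"
    by (simp add: v(2) vec_eq_iff)
  with v(1) show ?thesis by blast
qed

text \<open>The right-hand side is also the inner product with \<open>\<phi> k\<close> of the frame
  operator applied to \<open>\<phi> j\<close>. This turns an identity for the squared Gram matrix
  into one for the frame operator.\<close>

lemma gram_square_sum:
  fixes \<phi> :: "'n::finite \<Rightarrow> complex^'d"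
  shows "(gram \<phi> ** gram \<phi>) $ k $ j = (\<Sum>i\<in>UNIV. cinner (\<phi> j) (\<phi> i) * cinner (\<phi> i) (\<phi> k))"
  by (simp add: gram_def matrix_matrix_mult_def mult.commute)

text \<open>The difference \<open>w\<close> of the two sides lies in the span of the vectors, and
  the hypothesis on the Gram matrix makes it orthogonal to each of them; hence it is orthogonal to
  itself and vanishes.\<close>

lemma frame_operator_eigenvector:
  fixes \<phi> :: "'n::finite \<Rightarrow> complex^'d"
  assumes "gram \<phi> ** gram \<phi> = scale_mat q (gram \<phi>)"
  shows "(\<Sum>i\<in>UNIV. outer (\<phi> i)) *v \<phi> j = q *s \<phi> j"
proof -
  define w where "w = (\<Sum>i\<in>UNIV. outer (\<phi> i)) *v \<phi> j - q *s \<phi> j"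
  have "cinner w (\<phi> k) = (gram \<phi> ** gram \<phi>) $ k $ j - q * cinner (\<phi> j) (\<phi> k)" for k
    unfolding w_def gram_square_sum
    by (simp add: sum_outer_mult_vec cinner_diff_left cinner_sum_left cinner_scale_left)
  then have orth: "cinner w (\<phi> k) = 0" for k
    by (simp add: assms) (simp add: scale_mat_def gram_def)
  have "w \<in> vec.span (range \<phi>)"
    unfolding w_def sum_outer_mult_vec
    by (intro vec.span_diff vec.span_sum vec.span_scale vec.span_base) auto
  with orth have "cinner w w = 0"
    using cinner_eq_zero_span [of "range \<phi>" w w] by blast
  then have "w = 0" by (simp add: cinner_self)
  then show ?thesis by (simp add: w_def)
qed

lemma orthogonal_projection_frame_operator:
  fixes \<phi> :: "'n::finite \<Rightarrow> complex^'d" and q :: real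
  assumes "gram \<phi> ** gram \<phi> = scale_mat (of_real q) (gram \<phi>)" "q \<noteq> 0"
  shows "orthogonal_projection (scale_mat (of_real (inverse q)) (\<Sum>i\<in>UNIV. outer (\<phi> i)))
    (vec.span (range \<phi>))"
proof -
  define F where "F = (\<Sum>i\<in>UNIV. outer (\<phi> i))"
  have P: "scale_mat (of_real (inverse q)) F *v x = of_real (inverse q) *s (F *v x)" for x
    by (simp add: scale_mat_def matrix_vector_mult_def vec_eq_iff sum_distrib_left mult_ac)
  have "cinner (F *v x) (\<phi> k) = of_real q * cinner x (\<phi> k)" for x k
  proof -
    have "cinner (F *v x) (\<phi> k) = cinner x (of_real q *s \<phi> k)"
      unfolding F_def cinner_sum_outer_commute frame_operator_eigenvector [OF assms(1)] ..
    \<comment> \<open>Moving \<open>q\<close> out of the second argument conjugates it, which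
      changes nothing because \<open>q\<close> is real.\<close>
    also have "\<dots> = of_real q * cinner x (\<phi> k)"
      by (simp add: cinner_commute [of x] cinner_scale_left)
    finally show ?thesis .
  qed
  then have "cinner (x - of_real (inverse q) *s (F *v x)) (\<phi> k) = 0" for x k
    using assms(2) by (simp add: cinner_diff_left cinner_scale_left)
  then have "cinner (x - of_real (inverse q) *s (F *v x)) w = 0"
    if "w \<in> vec.span (range \<phi>)" for x w
    using that cinner_eq_zero_span [of "range \<phi>" _ w] by blast
  moreover have "of_real (inverse q) *s (F *v x) \<in> vec.span (range \<phi>)" for x
    unfolding F_def sum_outer_mult_vec
    by (intro vec.span_sum vec.span_scale vec.span_base) auto
  ultimately show ?thesis
    unfolding orthogonal_projection_def F_def [symmetric] P by blast
qed

text \<open>Applying the quadratic relation to the kernel vector leaves \<open>p *s v = 0\<close>,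
  so \<open>p = 0\<close>. A diagonal entry of what remains then expresses \<open>q\<close> as a sum
  of squared moduli.\<close>

lemma gram_square_real_if_singular:
  fixes \<phi> :: "'n::finite \<Rightarrow> complex^'d"
  assumes unit: "\<And>i. norm (\<phi> i) = 1"
    and quad: "gram \<phi> ** gram \<phi> = scale_mat p (mat 1) + scale_mat q (gram \<phi>)"
    and v: "v \<noteq> 0" "gram \<phi> *v v = 0"
  shows "\<exists>r::real. r > 0 \<and> gram \<phi> ** gram \<phi> = scale_mat (of_real r) (gram \<phi>)"
proof -
  have "(scale_mat p (mat 1) + scale_mat q (gram \<phi>)) *v v = p *s v + q *s (gram \<phi> *v v)"
    by (simp add: scale_mat_def matrix_vector_mult_def vec_eq_iff mat_def algebra_simps
        sum.distrib sum_distrib_left if_distrib [of "\<lambda>x. x * _"] if_distrib [of "\<lambda>x. _ * x"]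
        cong: if_cong)
  moreover have "(gram \<phi> ** gram \<phi>) *v v = 0"
    using v(2) by (simp flip: matrix_vector_mul_assoc)
  ultimately have "p = 0"
    using quad v by simp
  then have sq: "gram \<phi> ** gram \<phi> = scale_mat q (gram \<phi>)"
    using quad by (simp add: scale_mat_def vec_eq_iff)
  \<comment> \<open>Any index serves: the vectors have norm 1, so each diagonal entry of the Gram
    matrix is 1 and isolates \<open>q\<close>.\<close>
  fix i :: 'n
  define r where "r = (\<Sum>j\<in>UNIV. (cmod (cinner (\<phi> i) (\<phi> j)))\<^sup>2)"
  have "q = (gram \<phi> ** gram \<phi>) $ i $ i"
    unfolding sq by (simp add: scale_mat_def gram_def cinner_self unit)
  also have "\<dots> = of_real r"
    unfolding gram_square_sum r_def of_real_sum complex_norm_square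
    by (simp add: cinner_commute [of "\<phi> _" "\<phi> i"])
  finally have "q = of_real r" .
  \<comment> \<open>The term with \<open>j = i\<close> alone contributes 1 to
    \<open>r\<close>.\<close>
  moreover have "(cmod (cinner (\<phi> i) (\<phi> i)))\<^sup>2 \<le> r"
    unfolding r_def by (rule member_le_sum) auto
  then have "r > 0"
    by (simp add: cinner_self unit)
  ultimately show ?thesis
    using sq by blast
qed

section \<open>Equiangularity and tightness for representatives of roux lines\<close>

theorem corollary1p5:
  fixes L :: "'n::finite \<Rightarrow> (complex^'d) set"
  assumes "roux_lines TYPE('g::{finite, ab_group_add}) L"
  shows "\<exists>\<phi>. unit_norm_representatives L \<phi> \<and> etf_for_span \<phi>"
proof -
  obtain \<phi> and B :: "('g group_ring)^'n^'n" and \<alpha> where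
    dep: "linearly_dependent_lines L" and rep: "unit_norm_representatives L \<phi>"
    and B: "roux B" and \<alpha>: "character \<alpha>" and sig: "has_signature_matrix \<phi> (eval_char \<alpha> B)"
    using assms unfolding roux_lines_def by blast
  define S where "S = eval_char \<alpha> B"
  obtain \<mu> :: real where \<mu>: "\<mu> > 0" "gram \<phi> = mat 1 + scale_mat (of_real \<mu>) S"
    and unit: "\<And>i. norm (\<phi> i) = 1" and S: "signature_matrix S"
    using sig unfolding has_signature_matrix_def S_def by blast
  obtain a b where ab: "S ** S = scale_mat a (mat 1) + scale_mat b S"
    using roux_eval_char_quadratic [OF B \<alpha>] unfolding S_def by blast
  have "gram \<phi> ** gram \<phi>
      = mat 1 + scale_mat \<mu> S + scale_mat \<mu> S + scale_mat \<mu> S ** scale_mat \<mu> S"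
    by (simp add: \<mu>(2) matrix_add_ldistrib matrix_add_rdistrib add.assoc)
  also have "scale_mat (of_real \<mu>) S ** scale_mat (of_real \<mu>) S = scale_mat (\<mu>\<^sup>2) (S ** S)"
    by (simp add: scale_mat_def matrix_matrix_mult_def vec_eq_iff sum_distrib_left
        power2_eq_square mult_ac)
  \<comment> \<open>The coefficients come from replacing \<open>S ** S\<close> by
    \<open>a I + b S\<close> and then each \<open>\<mu> S\<close> by \<open>G - I\<close>, where
    \<open>G\<close> is the Gram matrix.\<close>
  also have "mat 1 + scale_mat \<mu> S + scale_mat \<mu> S + scale_mat (\<mu>\<^sup>2) (S ** S)
      = scale_mat (\<mu>\<^sup>2 * a - 1 - \<mu> * b) (mat 1) + scale_mat (2 + \<mu> * b) (gram \<phi>)"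
    using \<mu>(1) unfolding ab \<mu>(2)
    by (simp add: scale_mat_def vec_eq_iff algebra_simps power2_eq_square)
  finally have quad: "gram \<phi> ** gram \<phi> =
    scale_mat (\<mu>\<^sup>2 * a - 1 - \<mu> * b) (mat 1) + scale_mat (2 + \<mu> * b) (gram \<phi>)" .
  \<comment> \<open>Each representative lies on its line, so dependence of the lines bounds the
    dimension spanned by the vectors.\<close>
  have "vec.dim (range \<phi>) \<le> vec.dim (vec.span (\<Union>i. L i))"
    using rep unfolding unit_norm_representatives_def
    by (intro vec.dim_subset) (auto intro: vec.span_base)
  then have "vec.dim (range \<phi>) < CARD('n)"
    using dep unfolding linearly_dependent_lines_def by linarith
  then obtain v where "v \<noteq> 0" "gram \<phi> *v v = 0"
    using gram_singular by blast
  then obtain r :: real where r: "r > 0" "gram \<phi> ** gram \<phi> = scale_mat (of_real r) (gram \<phi>)"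
    using gram_square_real_if_singular [OF unit quad] by blast
  \<comment> \<open>Off the diagonal, the Gram matrix is \<mu> times entries of modulus 1.\<close>
  have "(cmod (cinner (\<phi> i) (\<phi> j)))\<^sup>2 = \<mu>\<^sup>2" if "i \<noteq> j" for i j
  proof -
    have "cinner (\<phi> i) (\<phi> j) = gram \<phi> $ j $ i"
      by (simp add: gram_def)
    also have "\<dots> = of_real \<mu> * S $ j $ i"
      using that by (simp add: \<mu>(2) scale_mat_def mat_def)
    moreover have "cmod (S $ j $ i) = 1"
      using S that unfolding signature_matrix_def by metis
    ultimately show ?thesis
      by (simp add: norm_mult)
  qed
  \<comment> \<open>The projection is the frame operator divided by \<open>r\<close>, so
    \<open>r\<close> is the scalar required for tightness.\<close>
  moreover have "(\<Sum>i\<in>UNIV. outer (\<phi> i))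
      = scale_mat (of_real r) (scale_mat (of_real (inverse r)) (\<Sum>i\<in>UNIV. outer (\<phi> i)))"
    using r(1) by (simp add: scale_mat_def vec_eq_iff flip: mult.assoc)
  moreover have "orthogonal_projection
      (scale_mat (of_real (inverse r)) (\<Sum>i\<in>UNIV. outer (\<phi> i))) (vec.span (range \<phi>))"
    using orthogonal_projection_frame_operator [OF r(2)] r(1) by simp
  ultimately have "etf_for_span \<phi>"
    unfolding etf_for_span_def using unit by blast
  with rep show ?thesis by blast
qed

end
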